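(* Let $Q\subset\mathbb{R}^2$ be a convex polygon. The functions $\mathcal{H}_{\mathrm{DC}},\mathcal{H}_{\mathrm{SP}}:Q^n\to\mathbb{R}$ are globally Lipschitz, with Lipschitz constant equal to $1$ (with respect to the Euclidean norm on $(\mathbb{R}^2)^n$).
   Context: $\|\cdot\|$ is the Euclidean norm, $\operatorname{Ed}(Q)$ is the set of edges of $Q$, and $\operatorname{D}_e(p)$ is the distance from $p$ to $e$. For $P=(p_1,\dots,p_n)\in Q^n$, $\mathcal{H}_{\mathrm{DC}}(P)=\max_{q\in Q}\min_{i\in\{1,\dots,n\}}\|q-p_i\|$ and $\mathcal{H}_{\mathrm{SP}}(P)=\min\{\tfrac12\|p_i-p_j\|,\ \operatorname{D}_e(p_i) : i,j\in\{1,\dots,n\},\ i\ne j,\ e\in\operatorname{Ed}(Q)\}$. *)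

theory Defs
  imports "HOL-Analysis.Analysis"
begin

definition convex_polygon :: "(real^2) set \<Rightarrow> bool" where
  "convex_polygon Q \<longleftrightarrow> polytope Q \<and> aff_dim Q = 2"

definition Ed :: "(real^2) set \<Rightarrow> (real^2) set set" where
  "Ed Q = {e. e edge_of Q}"

(* A configuration (p_1, ..., p_n) is a vector indexed by a finite type 'n with n = CARD('n) >= 1.
   The norm of real^2^'n is the L2 norm of the component norms, i.e. the Euclidean norm
   on (R^2)^n. *)
definition configs :: "(real^2) set \<Rightarrow> (real^2^'n) set" where
  "configs Q = {P. \<forall>i. P $ i \<in> Q}"

(* The maximum over q is written as a supremum because Max is only meaningful on finite sets;
   for nonempty compact Q the supremum is attained. *)
definition H_DC :: "(real^2) set \<Rightarrow> real^2^'n \<Rightarrow> real" where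
  "H_DC Q P = (SUP q\<in>Q. Min (range (\<lambda>i. norm (q - P $ i))))"

(* Written as a union so that for n = 1, where there is no pair i \<noteq> j, the minimum still
   ranges over the distances to the edges. *)
definition H_SP :: "(real^2) set \<Rightarrow> real^2^'n \<Rightarrow> real" where
  "H_SP Q P = Min ({1/2 * norm (P $ i - P $ j) | i j. i \<noteq> j} \<union> {infdist (P $ i) e | i e. e \<in> Ed Q})"

(* The least constant, not merely an admissible one. *)
definition has_lipschitz_constant ::
    "real \<Rightarrow> 'a::metric_space set \<Rightarrow> ('a \<Rightarrow> 'b::metric_space) \<Rightarrow> bool" where
  "has_lipschitz_constant L X f \<longleftrightarrow>
     L-lipschitz_on X f \<and> (\<forall>C. C-lipschitz_on X f \<longrightarrow> L \<le> C)"

end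

theory Submission
  imports Defs
begin

text \<open>
  Each function is built by minima and suprema from the 1-Lipschitz functions
  \<open>P \<mapsto> \<parallel>q - p\<^sub>i\<parallel>\<close>, \<open>P \<mapsto> \<parallel>p\<^sub>i - p\<^sub>j\<parallel> / 2\<close> and \<open>P \<mapsto> D\<^sub>e(p\<^sub>i)\<close>, which gives the upper bound.
  The constant is least because it is attained by moving a single point. For \<open>H\<^sub>D\<^sub>C\<close>, let \<open>v\<close> be
  the point of \<open>Q\<close> farthest from an interior point \<open>a\<close>, and let \<open>b\<close> be reached from \<open>a\<close> by moving
  straight away from \<open>v\<close>: compare \<open>(b, \<dots>, b)\<close> with the configuration in which one \<open>b\<close> is
  replaced by \<open>a\<close>. For \<open>H\<^sub>S\<^sub>P\<close>, let one point be so close to an edge that its distance to the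
  nearest edge determines the minimum, and move it to the nearest point on that edge.
\<close>

section \<open>Lipschitz constants and distances of configurations\<close>

lemma has_lipschitz_constant_1I:
  assumes "1-lipschitz_on X f" "x \<in> X" "y \<in> X" "x \<noteq> y" "dist x y \<le> dist (f x) (f y)"
  shows "has_lipschitz_constant 1 X f"
  unfolding has_lipschitz_constant_def
proof (intro conjI allI impI assms(1))
  fix C assume "C-lipschitz_on X f"
  then have "dist (f x) (f y) \<le> C * dist x y"
    using assms(2,3) by (rule lipschitz_onD)
  with assms(5) have "1 * dist x y \<le> C * dist x y" by simp
  with \<open>x \<noteq> y\<close> show "1 \<le> C"
    by (simp add: mult_le_cancel_right)
qed

lemma lipschitz_on_real_leI:
  fixes f :: "'a::metric_space \<Rightarrow> real"
  assumes "\<And>x y. x \<in> X \<Longrightarrow> y \<in> X \<Longrightarrow> f x \<le> f y + dist x y"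
  shows "1-lipschitz_on X f"
proof (rule lipschitz_onI)
  fix x y assume "x \<in> X" "y \<in> X"
  with assms[of x y] assms[of y x] show "dist (f x) (f y) \<le> 1 * dist x y"
    by (auto simp: dist_real_def dist_commute)
qed simp

text \<open>The Euclidean sum has a single nonzero term. This gives the distance of two
  configurations that differ in one point only.\<close>

lemma dist_vec_eq_nth:
  fixes x y :: "'a::metric_space^'n"
  assumes "\<And>i. i \<noteq> k \<Longrightarrow> x $ i = y $ i"
  shows "dist x y = dist (x $ k) (y $ k)"
proof -
  have "dist x y = L2_set (\<lambda>i. if i = k then dist (x $ k) (y $ k) else 0) UNIV"
    unfolding dist_vec_def using assms by (intro L2_set_cong) auto
  then show ?thesis
    by (simp add: L2_set_def if_distrib[of "\<lambda>x. x\<^sup>2"] cong: if_cong)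
qed

lemma finite_positive_lower_bound:
  fixes S :: "real set"
  assumes "finite S" "\<And>s. s \<in> S \<Longrightarrow> 0 < s"
  shows "\<exists>m>0. \<forall>s\<in>S. m \<le> s"
  \<comment> \<open>Inserting 1 keeps the minimum meaningful when \<open>S\<close> is empty.\<close>
  using assms by (intro exI[of _ "Min (insert 1 S)"]) auto

section \<open>Interior and edges of a convex polygon\<close>

lemma convex_polygon_interior_nonempty:
  assumes "convex_polygon Q"
  shows "interior Q \<noteq> {}"
proof -
  have "interior Q = rel_interior Q"
    using assms by (simp add: interior_rel_interior_gen convex_polygon_def)
  moreover have "Q \<noteq> {}" "convex Q"
    using assms by (auto simp: convex_polygon_def polytope_imp_convex)
  ultimately show ?thesis
    by (simp add: rel_interior_eq_empty)
qed

lemma finite_Ed: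
  assumes "convex_polygon Q"
  shows "finite (Ed Q)"
proof (rule finite_subset)
  show "Ed Q \<subseteq> {e. e face_of Q}" by (auto simp: Ed_def edge_of_def)
  show "finite {e. e face_of Q}"
    using assms by (simp add: convex_polygon_def finite_polytope_faces)
qed

lemma Ed_nonempty:
  assumes "convex_polygon Q"
  shows "Ed Q \<noteq> {}"
proof -
  obtain e where "e facet_of Q"
    using assms polytope_facet_exists[of Q] by (auto simp: convex_polygon_def)
  \<comment> \<open>A facet has affine dimension 2 - 1 = 1, so it is an edge.\<close>
  then have "e \<in> Ed Q"
    using assms by (auto simp: Ed_def edge_of_def facet_of_def convex_polygon_def)
  then show ?thesis by auto
qed

lemma
  assumes "convex_polygon Q" "e \<in> Ed Q"
  shows Ed_nonempty_edge: "e \<noteq> {}"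
    and Ed_closed: "closed e"
    and Ed_subset: "e \<subseteq> Q"
    and Ed_interior: "e \<inter> interior Q = {}"
proof -
  have e: "e face_of Q" "aff_dim e = 1"
    using assms by (auto simp: Ed_def edge_of_def)
  show "e \<noteq> {}" using e by auto
  show "closed e"
    using assms e face_of_polytope_polytope polytope_imp_closed
    by (auto simp: convex_polygon_def)
  show "e \<subseteq> Q" using e by (simp add: face_of_imp_subset)
  \<comment> \<open>The affine dimensions 1 and 2 differ; a proper face misses the interior.\<close>
  have "e \<noteq> Q" using assms e by (auto simp: convex_polygon_def)
  with e show "e \<inter> interior Q = {}"
    by (intro face_of_disjoint_interior) auto
qed

section \<open>The covering function \<open>H_DC\<close>\<close>

lemma bdd_above_H_DC:
  fixes P :: "real^2^'n"
  assumes "bounded Q"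
  shows "bdd_above ((\<lambda>q. Min (range (\<lambda>i. norm (q - P $ i)))) ` Q)"
proof -
  obtain B where B: "\<And>q. q \<in> Q \<Longrightarrow> norm q \<le> B"
    using assms by (auto simp: bounded_iff)
  show ?thesis
  proof (rule bdd_aboveI2)
    fix q assume "q \<in> Q"
    \<comment> \<open>Here \<open>undefined\<close> is just some index: any single point bounds the
      minimum.\<close>
    have "Min (range (\<lambda>i. norm (q - P $ i))) \<le> norm (q - P $ undefined)"
      by (intro Min_le) auto
    also have "\<dots> \<le> B + norm (P $ undefined)"
      using B[OF \<open>q \<in> Q\<close>] norm_triangle_ineq4[of q "P $ undefined"] by linarith
    finally show "Min (range (\<lambda>i. norm (q - P $ i))) \<le> B + norm (P $ undefined)" .
  qed
qed

lemma H_DC_ge: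
  fixes P :: "real^2^'n"
  assumes "bounded Q" "q \<in> Q" "\<And>i. c \<le> norm (q - P $ i)"
  shows "c \<le> H_DC Q P"
  unfolding H_DC_def
  by (rule cSUP_upper2[OF bdd_above_H_DC[OF assms(1)] assms(2)]) (use assms(3) in auto)

lemma H_DC_le:
  fixes P :: "real^2^'n"
  assumes "Q \<noteq> {}" "\<And>q. q \<in> Q \<Longrightarrow> \<exists>i. norm (q - P $ i) \<le> c"
  shows "H_DC Q P \<le> c"
  unfolding H_DC_def
  by (rule cSUP_least[OF assms(1)]) (use assms(2) in \<open>auto simp: Min_le_iff\<close>)

lemma H_DC_lipschitz:
  assumes "bounded Q" "Q \<noteq> {}"
  shows "1-lipschitz_on X (H_DC Q :: real^2^'n \<Rightarrow> real)"
proof (rule lipschitz_on_real_leI)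
  fix P P' :: "real^2^'n"
  show "H_DC Q P \<le> H_DC Q P' + dist P P'"
  proof (rule H_DC_le[OF assms(2)])
    fix q assume q: "q \<in> Q"
    \<comment> \<open>Take the index of the point of \<open>P'\<close> nearest to \<open>q\<close>;
      the point of \<open>P\<close> with this index is farther from \<open>q\<close> by at most
      \<open>dist P P'\<close>.\<close>
    have "Min (range (\<lambda>i. norm (q - P' $ i))) \<in> range (\<lambda>i. norm (q - P' $ i))"
      by (intro Min_in) auto
    then obtain i where i: "Min (range (\<lambda>i. norm (q - P' $ i))) = norm (q - P' $ i)"
      by (rule rangeE)
    have "norm (q - P' $ i) \<le> H_DC Q P'"
      unfolding i[symmetric] using assms(1) q
      by (rule H_DC_ge) auto
    moreover have "norm (q - P $ i) \<le> norm (q - P' $ i) + dist (P $ i) (P' $ i)"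
      by (metis dist_commute dist_norm dist_triangle)
    ultimately show "\<exists>i. norm (q - P $ i) \<le> H_DC Q P' + dist P P'"
      using dist_vec_nth_le[of P i P'] by (intro exI[of _ i]) linarith
  qed
qed

lemma H_DC_sharp:
  assumes "convex_polygon Q"
  obtains P P' :: "real^2^'n" where "P \<in> configs Q" "P' \<in> configs Q" "P \<noteq> P'"
    "dist P P' \<le> dist (H_DC Q P) (H_DC Q P')"
proof -
  have "compact Q" using assms by (simp add: convex_polygon_def polytope_imp_compact)
  obtain a where a: "a \<in> interior Q"
    using convex_polygon_interior_nonempty[OF assms] by auto
  then have "a \<in> Q" using interior_subset by auto
  obtain v where v: "v \<in> Q" "\<And>q. q \<in> Q \<Longrightarrow> dist a q \<le> dist a v"
    using distance_attains_sup[OF \<open>compact Q\<close>, of a] \<open>a \<in> Q\<close> by auto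
  have "v \<noteq> a"
  proof
    assume "v = a"
    then have "Q \<subseteq> {a}" using v(2) by auto
    then show False
      using a interior_mono[of Q "{a}"] by (auto simp: interior_singleton)
  qed
  obtain r where r: "0 < r" "ball a r \<subseteq> Q" using a by (auto simp: mem_interior)
  \<comment> \<open>This scaling puts \<open>b\<close> at distance \<open>r / 2\<close> from
    \<open>a\<close>, inside the ball.\<close>
  define s where "s = r / (2 * norm (a - v))"
  define b where "b = a + s *\<^sub>R (a - v)"
  have pos: "0 < s" using r \<open>v \<noteq> a\<close> by (simp add: s_def)
  have ab: "dist a b = s * norm (a - v)"
    using pos by (simp add: b_def dist_norm)
  also have "\<dots> < r" using r \<open>v \<noteq> a\<close> by (simp add: s_def)
  finally have "b \<in> Q" using r by auto
  have "b \<noteq> a" using ab pos \<open>v \<noteq> a\<close> by auto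
  \<comment> \<open>Since \<open>a\<close> lies on the segment from \<open>b\<close> to
    \<open>v\<close>, the two distances add up.\<close>
  have "b - v = (1 + s) *\<^sub>R (a - v)" by (simp add: b_def algebra_simps)
  then have "norm (b - v) = (1 + s) * norm (a - v)"
    using pos by simp
  then have bv: "norm (v - b) = dist a v + dist a b"
    using ab by (simp add: norm_minus_commute dist_norm algebra_simps)
  fix k :: 'n
  define P P' :: "real^2^'n" where "P = (\<chi> i. if i = k then a else b)" and "P' = (\<chi> i. b)"
  have d: "dist P P' = dist a b"
    by (subst dist_vec_eq_nth[of k]) (auto simp: P_def P'_def)
  \<comment> \<open>In \<open>P\<close> the point \<open>a\<close> alone covers \<open>Q\<close>
    within radius \<open>dist a v\<close>; in \<open>P'\<close> every point is at \<open>b\<close>,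
    which leaves \<open>v\<close> farther away by \<open>dist a b\<close>.\<close>
  have "H_DC Q P \<le> dist a v"
    using v by (intro H_DC_le) (auto simp: P_def dist_norm norm_minus_commute intro!: exI[of _ k])
  moreover have "dist a v + dist a b \<le> H_DC Q P'"
    using \<open>compact Q\<close> v(1) bv by (intro H_DC_ge[of Q v]) (auto simp: P'_def compact_imp_bounded)
  ultimately have "dist P P' \<le> dist (H_DC Q P) (H_DC Q P')"
    unfolding d dist_real_def by linarith
  moreover have "P \<noteq> P'" using d \<open>b \<noteq> a\<close> by auto
  moreover have "P \<in> configs Q" "P' \<in> configs Q"
    using \<open>a \<in> Q\<close> \<open>b \<in> Q\<close> by (auto simp: configs_def P_def P'_def)
  ultimately show thesis by (intro that)
qed

section \<open>The packing function \<open>H_SP\<close>\<close>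

lemma finite_H_SP_set:
  fixes P :: "real^2^'n"
  assumes "convex_polygon Q"
  shows "finite ({1/2 * norm (P $ i - P $ j) | i j. i \<noteq> j} \<union> {infdist (P $ i) e | i e. e \<in> Ed Q})"
proof -
  have "{1/2 * norm (P $ i - P $ j) | i j. i \<noteq> j} =
      (\<lambda>(i, j). 1/2 * norm (P $ i - P $ j)) ` {(i, j). i \<noteq> j}"
    by force
  moreover have "{infdist (P $ i) e | i e. e \<in> Ed Q} = (\<lambda>(i, e). infdist (P $ i) e) ` (UNIV \<times> Ed Q)"
    by auto
  ultimately show ?thesis
    using finite_Ed[OF assms] by (simp only: finite_Un finite_imageI finite_cartesian_product finite)
qed

lemma
  fixes P :: "real^2^'n"
  assumes "convex_polygon Q"
  shows H_SP_le_pair: "i \<noteq> j \<Longrightarrow> H_SP Q P \<le> 1/2 * norm (P $ i - P $ j)"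
    and H_SP_le_edge: "e \<in> Ed Q \<Longrightarrow> H_SP Q P \<le> infdist (P $ i) e"
  unfolding H_SP_def by (rule Min_le[OF finite_H_SP_set[OF assms]]; auto)+

lemma H_SP_ge:
  fixes P :: "real^2^'n"
  assumes "convex_polygon Q"
    and "\<And>i j. i \<noteq> j \<Longrightarrow> c \<le> 1/2 * norm (P $ i - P $ j)"
    and "\<And>i e. e \<in> Ed Q \<Longrightarrow> c \<le> infdist (P $ i) e"
  shows "c \<le> H_SP Q P"
proof -
  let ?S = "{1/2 * norm (P $ i - P $ j) | i j. i \<noteq> j} \<union> {infdist (P $ i) e | i e. e \<in> Ed Q}"
  have "Min ?S \<in> ?S"
    \<comment> \<open>The edge distances make the set nonempty even when there is no pair of
      distinct indices.\<close>
    by (rule Min_in[OF finite_H_SP_set[OF assms(1)]]) (use Ed_nonempty[OF assms(1)] in auto)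
  moreover have "c \<le> s" if "s \<in> ?S" for s
    using that assms(2,3) by blast
  ultimately show ?thesis
    unfolding H_SP_def by blast
qed

text \<open>Both points of a pair may move, each by at most \<open>dist P P'\<close>; the factor 1/2
  on their distance compensates for this.\<close>

lemma H_SP_lipschitz:
  assumes "convex_polygon Q"
  shows "1-lipschitz_on X (H_SP Q :: real^2^'n \<Rightarrow> real)"
proof (rule lipschitz_on_real_leI)
  fix P P' :: "real^2^'n"
  note nth = dist_vec_nth_le[of P _ P']
  have "H_SP Q P - dist P P' \<le> H_SP Q P'"
  proof (rule H_SP_ge[OF assms])
    fix i j :: 'n assume "i \<noteq> j"
    have "norm (P $ i - P $ j) \<le> dist (P $ i) (P' $ i) + norm (P' $ i - P' $ j) + dist (P $ j) (P' $ j)"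
      unfolding dist_norm by norm
    with H_SP_le_pair[OF assms \<open>i \<noteq> j\<close>, of P] nth[of i] nth[of j]
    show "H_SP Q P - dist P P' \<le> 1/2 * norm (P' $ i - P' $ j)" by argo
  next
    fix i e assume "e \<in> Ed Q"
    from H_SP_le_edge[OF assms this, of P i] infdist_triangle[of "P $ i" e "P' $ i"] nth[of i]
    show "H_SP Q P - dist P P' \<le> infdist (P' $ i) e" by linarith
  qed
  then show "H_SP Q P \<le> H_SP Q P' + dist P P'" by simp
qed

lemma H_SP_sharp:
  assumes Q: "convex_polygon Q"
  obtains P P' :: "real^2^'n" where "P \<in> configs Q" "P' \<in> configs Q" "P \<noteq> P'"
    "dist P P' \<le> dist (H_SP Q P) (H_SP Q P')"
proof -
  have "infinite (interior Q)"
    using convex_polygon_interior_nonempty[OF Q] empty_interior_finite[of "interior Q"] by auto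
  then obtain B where B: "finite B" "card B = CARD('n)" "B \<subseteq> interior Q"
    using infinite_arbitrarily_large by blast
  then obtain c :: "'n \<Rightarrow> real^2" where "bij_betw c UNIV B"
    using finite_same_card_bij[of "UNIV :: 'n set" B] by auto
  then have c_inj: "inj c" and c_int: "\<And>i. c i \<in> interior Q"
    using B by (auto simp: bij_betw_def)
  have interior_pos: "0 < infdist x e" if "x \<in> interior Q" "e \<in> Ed Q" for x e
    using that Ed_interior[OF Q that(2)] Ed_closed[OF Q that(2)] Ed_nonempty_edge[OF Q that(2)]
    by (intro infdist_pos_not_in_closed) auto
  obtain e0 y where y: "e0 \<in> Ed Q" "y \<in> e0"
    using Ed_nonempty[OF Q] Ed_nonempty_edge[OF Q] by fast
  fix k :: 'n
  \<comment> \<open>These are the quantities that must not determine the minimum once one point is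
    placed near \<open>y\<close>. All are positive: the \<open>c i\<close> are distinct and
    interior, whereas \<open>y\<close> lies on an edge.\<close>
  define S where "S = (\<lambda>(i, j). 1/2 * norm (c i - c j)) ` {(i, j). i \<noteq> j}
    \<union> (\<lambda>(i, e). infdist (c i) e) ` (UNIV \<times> Ed Q) \<union> range (\<lambda>i. 1/2 * norm (y - c i))"
  have "finite S" unfolding S_def using finite_Ed[OF Q] by simp
  moreover have "0 < s" if "s \<in> S" for s
    using that c_inj c_int interior_pos Ed_interior[OF Q y(1)] y(2)
    by (fastforce simp: S_def inj_eq)
  ultimately obtain m where m: "0 < m" "\<And>s. s \<in> S \<Longrightarrow> m \<le> s"
    using finite_positive_lower_bound[of S] by blast
  have m_pair: "m \<le> 1/2 * norm (c i - c j)" if "i \<noteq> j" for i j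
    using that by (intro m) (auto simp: S_def)
  have m_edge: "m \<le> infdist (c i) e" if "e \<in> Ed Q" for i e
    using that by (intro m) (auto simp: S_def)
  have m_y: "m \<le> 1/2 * norm (y - c i)" for i
    by (intro m) (auto simp: S_def)
  have "y \<in> closure (interior Q)"
    using Ed_subset[OF Q y(1)] y(2) Q convex_closure_interior[of Q]
      convex_polygon_interior_nonempty[OF Q] closure_subset
    by (auto simp: convex_polygon_def polytope_imp_convex)
  then obtain x where x: "x \<in> interior Q" "dist x y < m / 2"
    using m(1) by (metis closure_approachable half_gt_zero)
  \<comment> \<open>The moving point will run from \<open>z\<close>, its nearest point on the edges,
    to \<open>x\<close>, a path of length \<open>r\<close>.\<close>
  define r where "r = Min ((\<lambda>e. infdist x e) ` Ed Q)"
  have r_le: "r \<le> infdist x e" if "e \<in> Ed Q" for e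
    unfolding r_def using that finite_Ed[OF Q] by auto
  have "r \<in> (\<lambda>e. infdist x e) ` Ed Q"
    unfolding r_def using finite_Ed[OF Q] Ed_nonempty[OF Q] by (intro Min_in) auto
  then obtain e where e: "e \<in> Ed Q" "r = infdist x e" by auto
  obtain z where z: "z \<in> e" "infdist x e = dist x z"
    using infdist_attains_inf[OF Ed_closed[OF Q e(1)] Ed_nonempty_edge[OF Q e(1)], of x] by auto
  have "0 < r" using interior_pos[OF x(1) e(1)] e(2) by simp
  have "r < m / 2" using r_le[OF y(1)] infdist_le[OF y(2), of x] x(2) by linarith
  define P P' :: "real^2^'n"
    where "P = (\<chi> i. if i = k then z else c i)" and "P' = (\<chi> i. if i = k then x else c i)"
  have d: "dist P P' = r"
    by (subst dist_vec_eq_nth[of k]) (auto simp: P_def P'_def e z dist_commute)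
  \<comment> \<open>In \<open>P\<close> the point \<open>z\<close> lies on the edge
    \<open>e\<close>.\<close>
  have "H_SP Q P \<le> 0"
    using H_SP_le_edge[OF Q e(1), of P k] z(1) by (simp add: P_def)
  moreover have "r \<le> H_SP Q P'"
  proof (rule H_SP_ge[OF Q])
    \<comment> \<open>As \<open>y\<close> is at least \<open>2 * m\<close> from \<open>c j\<close>
      and \<open>x\<close> is within \<open>m / 2\<close> of \<open>y\<close>, half the distance
      from \<open>x\<close> to \<open>c j\<close> exceeds \<open>3 * m / 4\<close>, hence
      \<open>r\<close>.\<close>
    have near: "r \<le> 1/2 * norm (x - c j)" for j
      using m_y[of j] dist_triangle[of y "c j" x] x(2) \<open>r < m / 2\<close> m(1)
      by (simp add: dist_norm norm_minus_commute)
    fix i j :: 'n assume "i \<noteq> j"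
    then show "r \<le> 1/2 * norm (P' $ i - P' $ j)"
      using near[of i] near[of j] m_pair[of i j] \<open>r < m / 2\<close> m(1)
      by (auto simp: P'_def norm_minus_commute)
  next
    fix i e assume "e \<in> Ed Q"
    then show "r \<le> infdist (P' $ i) e"
      using r_le[of e] m_edge[of e i] \<open>r < m / 2\<close> m(1) by (auto simp: P'_def)
  qed
  ultimately have "dist P P' \<le> dist (H_SP Q P) (H_SP Q P')"
    unfolding d dist_real_def by linarith
  moreover have "P \<noteq> P'" using d \<open>0 < r\<close> by auto
  moreover have "P \<in> configs Q" "P' \<in> configs Q"
    using c_int x(1) interior_subset[of Q] z(1) Ed_subset[OF Q e(1)]
    by (auto simp: configs_def P_def P'_def)
  ultimately show thesis by (intro that)
qed

theorem proposition4p2: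
  fixes Q :: "(real^2) set"
  assumes "convex_polygon Q"
  shows "has_lipschitz_constant 1 (configs Q) (H_DC Q :: real^2^'n \<Rightarrow> real) \<and>
         has_lipschitz_constant 1 (configs Q) (H_SP Q :: real^2^'n \<Rightarrow> real)"
proof
  have "bounded Q" "Q \<noteq> {}"
    using assms by (auto simp: convex_polygon_def polytope_imp_bounded)
  then have "1-lipschitz_on (configs Q) (H_DC Q :: real^2^'n \<Rightarrow> real)"
    by (rule H_DC_lipschitz)
  with H_DC_sharp[OF assms] show "has_lipschitz_constant 1 (configs Q) (H_DC Q :: real^2^'n \<Rightarrow> real)"
    by (metis has_lipschitz_constant_1I)
  from H_SP_sharp[OF assms] H_SP_lipschitz[OF assms]
  show "has_lipschitz_constant 1 (configs Q) (H_SP Q :: real^2^'n \<Rightarrow> real)"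
    by (metis has_lipschitz_constant_1I)
qed

end
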